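(* Let $\ast_c$ be a choice revision on $K$. Then $\ast_c$ satisfies $\ast_c$-closure, $\ast_c$-success, $\ast_c$-vacuity, $\ast_c$-confirmation, $\ast_c$-reciprocity and $\ast_c$-consistency iff there is a standard multi-believability relation $\preceq_{c}$ such that for every finite $A$: $K \ast_c A = \{\varphi \mid A \simeq_{c} \{\psi\wedge\varphi \mid \psi\in A\}\}$ if $A \prec_{c} \emptyset$, and $K \ast_c A = K$ otherwise.
   Context: $\mathcal{L}$ is a propositional language (not necessarily finite) with consequence operation $\mathrm{Cn}$ (supraclassical, compact, deduction property); $X\vdash\varphi$ means $\varphi\in\mathrm{Cn}(X)$; $\bot$ is a contradiction. $K$ is a fixed consistent belief set ($K=\mathrm{Cn}(K)$). $A\equiv B$ means every element of $A$ is logically equivalent to some element of $B$ and vice versa. A choice revision $\ast_c$ on $K$ maps each finite $A\subseteq\mathcal{L}$ to a set $K\ast_c A$. Postulates (finite $A,B$): closure: $\mathrm{Cn}(K\ast_c A)=K\ast_c A$; success: if $A\neq\emptyset$ then $A\cap(K\ast_c A)\neq\emptyset$; vacuity: if $A=\emptyset$ then $K\ast_c A=K$; confirmation: if $A\cap K\neq\emptyset$ then $K\ast_c A=K$; reciprocity: if $(K\ast_c A)\cap B\neq\emptyset$ and $(K\ast_c B)\cap A\neq\emptyset$ then $K\ast_c A=K\ast_c B$; consistency: if $A\not\equiv\{\bot\}$ then $K\ast_c A\nvdash\bot$. A multi-believability relation $\preceq_{c}$ is a binary relation on finite subsets of $\mathcal{L}$ (symmetric part $\simeq_{c}$, strict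 part $\prec_{c}$; $\{\varphi\}$ written $\varphi$). It is standard iff it satisfies, for finite $A,B,C$: transitivity; weak coupling (if $A\simeq_{c}\{\varphi\wedge\psi\mid\varphi\in A,\psi\in B\}$ and $A\simeq_{c}\{\varphi\wedge\chi\mid\varphi\in A,\chi\in C\}$ then $A\simeq_{c}\{(\varphi\wedge\psi)\wedge\chi\mid\varphi\in A,\psi\in B,\chi\in C\}$); coupling (if $A\simeq_{c}B$ then $A\simeq_{c}\{\varphi\wedge\psi\mid\varphi\in A,\psi\in B\}$); counter dominance (if for every $\varphi\in B$ there is $\psi\in A$ with $\varphi\vdash\psi$ then $A\preceq_{c}B$); minimality ($A\preceq_{c}B$ for all $B$ iff $A\cap K\neq\emptyset$); maximality (if $B$ non-empty and $A\preceq_{c}B$ for all non-empty $A$ then $B\equiv\{\bot\}$); completeness ($A\preceq_{c}B$ or $B\preceq_{c}A$); determination ($A\prec_{c}\emptyset$ for every non-empty $A$); union ($A\preceq_{c}A\cup B$ or $B\preceq_{c}A\cup B$). *)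

theory Defs
  imports Main
begin

datatype 'v form =
    Atom 'v
  | Neg "'v form"
  | Conj "'v form" "'v form"  (infixr "\<^bold>\<and>" 65)
  | Disj "'v form" "'v form"  (infixr "\<^bold>\<or>" 60)
  | Imp "'v form" "'v form"   (infixr "\<^bold>\<rightarrow>" 55)

(* The choice of the atom is immaterial: all contradictions are equivalent under a
   supraclassical consequence operation. *)
definition Falsum :: "'v form"  ("\<^bold>\<bottom>") where
  "\<^bold>\<bottom> = Atom undefined \<^bold>\<and> Neg (Atom undefined)"

primrec sat :: "('v \<Rightarrow> bool) \<Rightarrow> 'v form \<Rightarrow> bool" where
  "sat v (Atom p) \<longleftrightarrow> v p"
| "sat v (Neg \<phi>) \<longleftrightarrow> \<not> sat v \<phi>"
| "sat v (\<phi> \<^bold>\<and> \<psi>) \<longleftrightarrow> sat v \<phi> \<and> sat v \<psi>"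
| "sat v (\<phi> \<^bold>\<or> \<psi>) \<longleftrightarrow> sat v \<phi> \<or> sat v \<psi>"
| "sat v (\<phi> \<^bold>\<rightarrow> \<psi>) \<longleftrightarrow> (sat v \<phi> \<longrightarrow> sat v \<psi>)"

definition classical_Cn :: "'v form set \<Rightarrow> 'v form set" where
  "classical_Cn X = {\<phi>. \<forall>v. (\<forall>\<chi>\<in>X. sat v \<chi>) \<longrightarrow> sat v \<phi>}"

(* The first three conditions say that Cn is a consequence operation in Tarski's sense. *)
locale consequence_operation =
  fixes Cn :: "'v form set \<Rightarrow> 'v form set"
  assumes inclusion: "X \<subseteq> Cn X"
    and monotony: "X \<subseteq> Y \<Longrightarrow> Cn X \<subseteq> Cn Y"
    and iteration: "Cn (Cn X) = Cn X"
    and supraclassicality: "classical_Cn X \<subseteq> Cn X"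
    and compactness: "\<phi> \<in> Cn X \<Longrightarrow> \<exists>Y. finite Y \<and> Y \<subseteq> X \<and> \<phi> \<in> Cn Y"
    and deduction: "\<psi> \<in> Cn (X \<union> {\<phi>}) \<longleftrightarrow> \<phi> \<^bold>\<rightarrow> \<psi> \<in> Cn X"

type_synonym 'v cn = "'v form set \<Rightarrow> 'v form set"

definition belief_set :: "'v cn \<Rightarrow> 'v form set \<Rightarrow> bool" where
  "belief_set Cn K \<longleftrightarrow> K = Cn K"

definition consistent :: "'v cn \<Rightarrow> 'v form set \<Rightarrow> bool" where
  "consistent Cn X \<longleftrightarrow> \<^bold>\<bottom> \<notin> Cn X"

definition entails :: "'v cn \<Rightarrow> 'v form \<Rightarrow> 'v form \<Rightarrow> bool" where
  "entails Cn \<phi> \<psi> \<longleftrightarrow> \<psi> \<in> Cn {\<phi>}"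

definition equivalent :: "'v cn \<Rightarrow> 'v form \<Rightarrow> 'v form \<Rightarrow> bool" where
  "equivalent Cn \<phi> \<psi> \<longleftrightarrow> entails Cn \<phi> \<psi> \<and> entails Cn \<psi> \<phi>"

definition set_equivalent :: "'v cn \<Rightarrow> 'v form set \<Rightarrow> 'v form set \<Rightarrow> bool" where
  "set_equivalent Cn A B \<longleftrightarrow>
     (\<forall>\<phi>\<in>A. \<exists>\<psi>\<in>B. equivalent Cn \<phi> \<psi>) \<and> (\<forall>\<psi>\<in>B. \<exists>\<phi>\<in>A. equivalent Cn \<psi> \<phi>)"


(* A choice revision R on K maps A to the revision of K by A.  Only its values at finite
   sets matter: every condition below quantifies over finite sets only. *)

type_synonym 'v revision = "'v form set \<Rightarrow> 'v form set"

definition rev_closure :: "'v cn \<Rightarrow> 'v revision \<Rightarrow> bool" where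
  "rev_closure Cn R \<longleftrightarrow> (\<forall>A. finite A \<longrightarrow> Cn (R A) = R A)"

definition rev_success :: "'v revision \<Rightarrow> bool" where
  "rev_success R \<longleftrightarrow> (\<forall>A. finite A \<longrightarrow> A \<noteq> {} \<longrightarrow> A \<inter> R A \<noteq> {})"

definition rev_vacuity :: "'v form set \<Rightarrow> 'v revision \<Rightarrow> bool" where
  "rev_vacuity K R \<longleftrightarrow> (\<forall>A. finite A \<longrightarrow> A = {} \<longrightarrow> R A = K)"

definition rev_confirmation :: "'v form set \<Rightarrow> 'v revision \<Rightarrow> bool" where
  "rev_confirmation K R \<longleftrightarrow> (\<forall>A. finite A \<longrightarrow> A \<inter> K \<noteq> {} \<longrightarrow> R A = K)"

definition rev_reciprocity :: "'v revision \<Rightarrow> bool" where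
  "rev_reciprocity R \<longleftrightarrow>
     (\<forall>A B. finite A \<longrightarrow> finite B \<longrightarrow> R A \<inter> B \<noteq> {} \<longrightarrow> R B \<inter> A \<noteq> {} \<longrightarrow> R A = R B)"

definition rev_consistency :: "'v cn \<Rightarrow> 'v revision \<Rightarrow> bool" where
  "rev_consistency Cn R \<longleftrightarrow>
     (\<forall>A. finite A \<longrightarrow> \<not> set_equivalent Cn A {\<^bold>\<bottom>} \<longrightarrow> consistent Cn (R A))"


(* A multi-believability relation is likewise a relation on sets of which only the
   restriction to finite sets matters. *)

type_synonym 'v multi_bel = "'v form set \<Rightarrow> 'v form set \<Rightarrow> bool"

definition sym_part :: "'v multi_bel \<Rightarrow> 'v multi_bel" where
  "sym_part le A B \<longleftrightarrow> le A B \<and> le B A"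

definition strict_part :: "'v multi_bel \<Rightarrow> 'v multi_bel" where
  "strict_part le A B \<longleftrightarrow> le A B \<and> \<not> le B A"

definition mb_transitivity :: "'v multi_bel \<Rightarrow> bool" where
  "mb_transitivity le \<longleftrightarrow>
     (\<forall>A B C. finite A \<longrightarrow> finite B \<longrightarrow> finite C \<longrightarrow> le A B \<longrightarrow> le B C \<longrightarrow> le A C)"

definition mb_weak_coupling :: "'v multi_bel \<Rightarrow> bool" where
  "mb_weak_coupling le \<longleftrightarrow>
     (\<forall>A B C. finite A \<longrightarrow> finite B \<longrightarrow> finite C \<longrightarrow>
        sym_part le A {\<phi> \<^bold>\<and> \<psi> | \<phi> \<psi>. \<phi> \<in> A \<and> \<psi> \<in> B} \<longrightarrow>
        sym_part le A {\<phi> \<^bold>\<and> \<chi> | \<phi> \<chi>. \<phi> \<in> A \<and> \<chi> \<in> C} \<longrightarrow>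
        sym_part le A {(\<phi> \<^bold>\<and> \<psi>) \<^bold>\<and> \<chi> | \<phi> \<psi> \<chi>. \<phi> \<in> A \<and> \<psi> \<in> B \<and> \<chi> \<in> C})"

definition mb_coupling :: "'v multi_bel \<Rightarrow> bool" where
  "mb_coupling le \<longleftrightarrow>
     (\<forall>A B. finite A \<longrightarrow> finite B \<longrightarrow> sym_part le A B \<longrightarrow>
        sym_part le A {\<phi> \<^bold>\<and> \<psi> | \<phi> \<psi>. \<phi> \<in> A \<and> \<psi> \<in> B})"

definition mb_counter_dominance :: "'v cn \<Rightarrow> 'v multi_bel \<Rightarrow> bool" where
  "mb_counter_dominance Cn le \<longleftrightarrow>
     (\<forall>A B. finite A \<longrightarrow> finite B \<longrightarrow> (\<forall>\<phi>\<in>B. \<exists>\<psi>\<in>A. entails Cn \<phi> \<psi>) \<longrightarrow> le A B)"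

definition mb_minimality :: "'v form set \<Rightarrow> 'v multi_bel \<Rightarrow> bool" where
  "mb_minimality K le \<longleftrightarrow>
     (\<forall>A. finite A \<longrightarrow> ((\<forall>B. finite B \<longrightarrow> le A B) \<longleftrightarrow> A \<inter> K \<noteq> {}))"

definition mb_maximality :: "'v cn \<Rightarrow> 'v multi_bel \<Rightarrow> bool" where
  "mb_maximality Cn le \<longleftrightarrow>
     (\<forall>B. finite B \<longrightarrow> B \<noteq> {} \<longrightarrow> (\<forall>A. finite A \<longrightarrow> A \<noteq> {} \<longrightarrow> le A B) \<longrightarrow>
        set_equivalent Cn B {\<^bold>\<bottom>})"

definition mb_completeness :: "'v multi_bel \<Rightarrow> bool" where
  "mb_completeness le \<longleftrightarrow> (\<forall>A B. finite A \<longrightarrow> finite B \<longrightarrow> le A B \<or> le B A)"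

definition mb_determination :: "'v multi_bel \<Rightarrow> bool" where
  "mb_determination le \<longleftrightarrow> (\<forall>A. finite A \<longrightarrow> A \<noteq> {} \<longrightarrow> strict_part le A {})"

definition mb_union :: "'v multi_bel \<Rightarrow> bool" where
  "mb_union le \<longleftrightarrow>
     (\<forall>A B. finite A \<longrightarrow> finite B \<longrightarrow> le A (A \<union> B) \<or> le B (A \<union> B))"

definition standard :: "'v cn \<Rightarrow> 'v form set \<Rightarrow> 'v multi_bel \<Rightarrow> bool" where
  "standard Cn K le \<longleftrightarrow>
     mb_transitivity le \<and> mb_weak_coupling le \<and> mb_coupling le \<and>
     mb_counter_dominance Cn le \<and> mb_minimality K le \<and> mb_maximality Cn le \<and>
     mb_completeness le \<and> mb_determination le \<and> mb_union le"

end

(* A relation is obtained from a revision by letting A be at most as hard to accept as B iff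
   revising by A \<union> B yields an element of A.  The key is that R X = R Y whenever Y \<subseteq> X and R X
   meets Y (success and reciprocity), which gives transitivity and shows that equally hard sets
   have the same revision.  Conversely, union and transitivity give each non-empty finite A an
   element as believable as A itself, and by coupling that element lies in the revision by A. *)
theory Submission
  imports Defs
begin

section \<open>Pairwise conjunctions of sets of formulas\<close>

definition conj_set :: "'v form set \<Rightarrow> 'v form set \<Rightarrow> 'v form set" where
  "conj_set A B = {\<phi> \<^bold>\<and> \<psi> | \<phi> \<psi>. \<phi> \<in> A \<and> \<psi> \<in> B}"

lemma conj_setI: "\<phi> \<in> A \<Longrightarrow> \<psi> \<in> B \<Longrightarrow> \<phi> \<^bold>\<and> \<psi> \<in> conj_set A B"
  by (auto simp: conj_set_def)

lemma conj_setE: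
  assumes "\<chi> \<in> conj_set A B"
  obtains \<phi> \<psi> where "\<chi> = \<phi> \<^bold>\<and> \<psi>" "\<phi> \<in> A" "\<psi> \<in> B"
  using assms by (auto simp: conj_set_def)

lemma conj_set_empty_left [simp]: "conj_set {} B = {}"
  by (simp add: conj_set_def)

lemma conj_set_singleton: "{\<psi> \<^bold>\<and> \<phi> | \<psi>. \<psi> \<in> A} = conj_set A {\<phi>}"
  by (auto simp: conj_set_def)

text \<open>Lets the threefold comprehension of weak coupling be folded into nested
  \<open>conj_set\<close>.\<close>

lemma conj_set_triple:
  "{(\<phi> \<^bold>\<and> \<psi>) \<^bold>\<and> \<chi> | \<phi> \<psi> \<chi>. \<phi> \<in> A \<and> \<psi> \<in> B \<and> \<chi> \<in> C} = conj_set (conj_set A B) C"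
  unfolding conj_set_def by blast

lemma finite_conj_set [simp]:
  assumes "finite A" "finite B"
  shows "finite (conj_set A B)"
proof -
  have "conj_set A B = (\<lambda>(\<phi>, \<psi>). \<phi> \<^bold>\<and> \<psi>) ` (A \<times> B)"
    by (auto simp: conj_set_def)
  then show ?thesis
    using assms by simp
qed

section \<open>Classical reasoning inside a consequence operation\<close>

context consequence_operation
begin

lemma Cn_subset: "X \<subseteq> Cn Y \<Longrightarrow> Cn X \<subseteq> Cn Y"
  using monotony[of X "Cn Y"] iteration by simp

lemma Cn_entails: "\<phi> \<in> Cn X \<Longrightarrow> entails Cn \<phi> \<psi> \<Longrightarrow> \<psi> \<in> Cn X"
  using Cn_subset[of "{\<phi>}" X] by (auto simp: entails_def)

lemma classical_CnI: "(\<And>v. \<forall>\<chi>\<in>X. sat v \<chi> \<Longrightarrow> sat v \<phi>) \<Longrightarrow> \<phi> \<in> Cn X"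
  using supraclassicality by (auto simp: classical_Cn_def)

lemma classical_entailsI: "(\<And>v. sat v \<phi> \<Longrightarrow> sat v \<psi>) \<Longrightarrow> entails Cn \<phi> \<psi>"
  unfolding entails_def by (rule classical_CnI) auto

lemma entails_refl: "entails Cn \<phi> \<phi>"
  by (rule classical_entailsI)

lemma entails_trans: "entails Cn \<phi> \<psi> \<Longrightarrow> entails Cn \<psi> \<chi> \<Longrightarrow> entails Cn \<phi> \<chi>"
  unfolding entails_def[of Cn \<phi>] by (rule Cn_entails)

lemma conj_entails_left: "entails Cn (\<phi> \<^bold>\<and> \<psi>) \<phi>"
  and conj_entails_right: "entails Cn (\<phi> \<^bold>\<and> \<psi>) \<psi>"
  by (rule classical_entailsI; simp)+

lemma Falsum_entails: "entails Cn \<^bold>\<bottom> \<phi>"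
  by (rule classical_entailsI) (simp add: Falsum_def)

lemma Cn_conj_iff: "\<phi> \<^bold>\<and> \<psi> \<in> Cn X \<longleftrightarrow> \<phi> \<in> Cn X \<and> \<psi> \<in> Cn X"
proof
  assume "\<phi> \<^bold>\<and> \<psi> \<in> Cn X"
  then show "\<phi> \<in> Cn X \<and> \<psi> \<in> Cn X"
    using Cn_entails conj_entails_left conj_entails_right by blast
next
  assume "\<phi> \<in> Cn X \<and> \<psi> \<in> Cn X"
  then have "Cn {\<phi>, \<psi>} \<subseteq> Cn X"
    by (simp add: Cn_subset)
  moreover have "\<phi> \<^bold>\<and> \<psi> \<in> Cn {\<phi>, \<psi>}"
    by (rule classical_CnI) auto
  ultimately show "\<phi> \<^bold>\<and> \<psi> \<in> Cn X" by blast
qed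

lemma entails_conjI: "entails Cn \<phi> \<psi> \<Longrightarrow> entails Cn \<phi> \<chi> \<Longrightarrow> entails Cn \<phi> (\<psi> \<^bold>\<and> \<chi>)"
  by (simp add: entails_def Cn_conj_iff)

lemma conj_mono: "entails Cn \<phi> \<phi>' \<Longrightarrow> entails Cn \<psi> \<psi>' \<Longrightarrow> entails Cn (\<phi> \<^bold>\<and> \<psi>) (\<phi>' \<^bold>\<and> \<psi>')"
  by (meson conj_entails_left conj_entails_right entails_conjI entails_trans)

text \<open>By compactness a consequence of \<open>S\<close> follows from finitely many members.
  Their conjunction is again in \<open>S\<close> and entails each of them, so weakening applies to a
  single formula.\<close>

lemma Cn_fixpointI:
  assumes "S \<noteq> {}"
    and conj: "\<And>\<phi> \<psi>. \<phi> \<in> S \<Longrightarrow> \<psi> \<in> S \<Longrightarrow> \<phi> \<^bold>\<and> \<psi> \<in> S"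
    and weaken: "\<And>\<phi> \<psi>. \<phi> \<in> S \<Longrightarrow> entails Cn \<phi> \<psi> \<Longrightarrow> \<psi> \<in> S"
  shows "Cn S = S"
proof
  \<comment> \<open>For empty \<open>Y\<close> any member of \<open>S\<close> will do, which is why
    \<open>S\<close> must be non-empty.\<close>
  have lower_bound: "\<exists>\<chi>\<in>S. \<forall>\<phi>\<in>Y. entails Cn \<chi> \<phi>" if "finite Y" "Y \<subseteq> S" for Y
    using that
  proof (induction Y)
    case empty
    then show ?case using \<open>S \<noteq> {}\<close> by auto
  next
    case (insert \<psi> Y)
    then obtain \<chi> where "\<chi> \<in> S" "\<forall>\<phi>\<in>Y. entails Cn \<chi> \<phi>"
      by auto
    then have "\<psi> \<^bold>\<and> \<chi> \<in> S \<and> (\<forall>\<phi>\<in>insert \<psi> Y. entails Cn (\<psi> \<^bold>\<and> \<chi>) \<phi>)"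
      using insert.prems conj[of \<psi> \<chi>] conj_entails_left entails_trans[OF conj_entails_right]
      by auto
    then show ?case by blast
  qed
  show "Cn S \<subseteq> S"
  proof
    fix \<phi>
    assume "\<phi> \<in> Cn S"
    then obtain Y where Y: "finite Y" "Y \<subseteq> S" "\<phi> \<in> Cn Y"
      using compactness by blast
    then obtain \<chi> where "\<chi> \<in> S" "Y \<subseteq> Cn {\<chi>}"
      using lower_bound[OF Y(1,2)] by (auto simp: entails_def)
    then show "\<phi> \<in> S"
      using Y(3) Cn_subset[of Y "{\<chi>}"] weaken[of \<chi> \<phi>] by (auto simp: entails_def)
  qed
qed (rule inclusion)

end


section \<open>The revision induced by a standard relation\<close>

section \<open>From relations to revisions\<close>

locale standard_relation = consequence_operation Cn
  for Cn :: "'v form set \<Rightarrow> 'v form set" +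
  fixes K :: "'v form set" and le :: "'v multi_bel"
  assumes belief: "belief_set Cn K"
    and consistent_K: "consistent Cn K"
    and standard: "standard Cn K le"
begin

abbreviation sim :: "'v form set \<Rightarrow> 'v form set \<Rightarrow> bool" (infix "\<simeq>" 50) where
  "A \<simeq> B \<equiv> sym_part le A B"

lemma le_trans: "le A B \<Longrightarrow> le B C \<Longrightarrow> finite A \<Longrightarrow> finite B \<Longrightarrow> finite C \<Longrightarrow> le A C"
  using standard unfolding standard_def mb_transitivity_def by blast

lemma sim_sym: "A \<simeq> B \<Longrightarrow> B \<simeq> A"
  by (auto simp: sym_part_def)

lemma weak_coupling:
  "A \<simeq> conj_set A B \<Longrightarrow> A \<simeq> conj_set A C \<Longrightarrow> finite A \<Longrightarrow> finite B \<Longrightarrow> finite C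
    \<Longrightarrow> A \<simeq> conj_set (conj_set A B) C"
  using standard
  unfolding standard_def mb_weak_coupling_def conj_set_triple conj_set_def[symmetric]
  by blast

lemma coupling: "A \<simeq> B \<Longrightarrow> finite A \<Longrightarrow> finite B \<Longrightarrow> A \<simeq> conj_set A B"
  using standard unfolding standard_def mb_coupling_def conj_set_def[symmetric] by blast

lemma counter_dominance:
  "finite A \<Longrightarrow> finite B \<Longrightarrow> (\<And>\<phi>. \<phi> \<in> B \<Longrightarrow> \<exists>\<psi>\<in>A. entails Cn \<phi> \<psi>) \<Longrightarrow> le A B"
  using standard unfolding standard_def mb_counter_dominance_def by blast

lemma minimal_iff: "finite A \<Longrightarrow> (\<forall>B. finite B \<longrightarrow> le A B) \<longleftrightarrow> A \<inter> K \<noteq> {}"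
  using standard unfolding standard_def mb_minimality_def by blast

lemma le_conj_set: "finite A \<Longrightarrow> finite B \<Longrightarrow> le A (conj_set A B)"
  using conj_entails_left by (intro counter_dominance) (auto elim!: conj_setE)

text \<open>Determination gives one direction; the other holds because a strict part is irreflexive.
  The case distinction of the theorem thus becomes a test for \<open>A = {}\<close>.\<close>

lemma strict_empty_iff: "finite A \<Longrightarrow> strict_part le A {} \<longleftrightarrow> A \<noteq> {}"
  using standard unfolding standard_def mb_determination_def strict_part_def by blast

text \<open>The first branch of the representation. At \<open>{}\<close> it would contain every
  formula, since \<open>conj_set {} B = {}\<close>; hence the separate value \<open>K\<close>
  there.\<close>

definition induced :: "'v form set \<Rightarrow> 'v form set" where
  "induced A = {\<phi>. A \<simeq> conj_set A {\<phi>}}"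

text \<open>The other half of the equivalence is free: a conjunction entails its first conjunct, so
  counter dominance applies.\<close>

lemma induced_iff: "finite A \<Longrightarrow> \<phi> \<in> induced A \<longleftrightarrow> le (conj_set A {\<phi>}) A"
  by (auto simp: induced_def sym_part_def le_conj_set)

lemma le_conj_set_singleton:
  assumes "finite A" "finite B" "entails Cn \<phi> \<psi>"
    and dominates: "\<And>\<beta>. \<beta> \<in> B \<Longrightarrow> \<exists>\<alpha>\<in>A. entails Cn \<beta> \<alpha>"
  shows "le (conj_set A {\<psi>}) (conj_set B {\<phi>})"
proof (rule counter_dominance)
  fix \<chi>
  assume "\<chi> \<in> conj_set B {\<phi>}"
  then obtain \<beta> where "\<chi> = \<beta> \<^bold>\<and> \<phi>" "\<beta> \<in> B"
    by (auto elim!: conj_setE)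
  moreover from this obtain \<alpha> where "\<alpha> \<in> A" "entails Cn \<beta> \<alpha>"
    using dominates by blast
  ultimately show "\<exists>\<psi>'\<in>conj_set A {\<psi>}. entails Cn \<chi> \<psi>'"
    using assms by (intro bexI[of _ "\<alpha> \<^bold>\<and> \<psi>"]) (simp_all add: conj_mono conj_setI)
qed (use assms in auto)

lemma induced_weaken:
  assumes "finite A" "\<phi> \<in> induced A" "entails Cn \<phi> \<psi>"
  shows "\<psi> \<in> induced A"
proof -
  have "le (conj_set A {\<psi>}) (conj_set A {\<phi>})"
    using assms entails_refl by (intro le_conj_set_singleton) auto
  then show ?thesis
    using assms le_trans[of "conj_set A {\<psi>}" "conj_set A {\<phi>}" A] by (simp add: induced_iff)
qed

text \<open>Weak coupling adds the two formulas to \<open>A\<close> one after the other; regrouping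
  the conjunction is a case of counter dominance.\<close>

lemma induced_conj:
  assumes "finite A" "\<phi> \<in> induced A" "\<psi> \<in> induced A"
  shows "\<phi> \<^bold>\<and> \<psi> \<in> induced A"
proof -
  have "A \<simeq> conj_set (conj_set A {\<phi>}) {\<psi>}"
    using assms by (intro weak_coupling) (auto simp: induced_def)
  moreover have "le (conj_set A {\<phi> \<^bold>\<and> \<psi>}) (conj_set (conj_set A {\<phi>}) {\<psi>})"
  proof (rule counter_dominance)
    fix \<chi>
    assume "\<chi> \<in> conj_set (conj_set A {\<phi>}) {\<psi>}"
    then obtain \<alpha> where "\<alpha> \<in> A" "\<chi> = (\<alpha> \<^bold>\<and> \<phi>) \<^bold>\<and> \<psi>"
      by (auto elim!: conj_setE)
    then show "\<exists>\<psi>'\<in>conj_set A {\<phi> \<^bold>\<and> \<psi>}. entails Cn \<chi> \<psi>'"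
      by (intro bexI[of _ "\<alpha> \<^bold>\<and> (\<phi> \<^bold>\<and> \<psi>)"] classical_entailsI conj_setI) auto
  qed (use assms in auto)
  ultimately show ?thesis
    using assms le_trans[of "conj_set A {\<phi> \<^bold>\<and> \<psi>}" "conj_set (conj_set A {\<phi>}) {\<psi>}" A]
    by (simp add: induced_iff sym_part_def)
qed

text \<open>Union compares the new singleton and the old set with their union. If the old set wins,
  its most believable element is carried over by transitivity.\<close>

lemma exists_most_believable:
  assumes "finite A" "A \<noteq> {}"
  shows "\<exists>\<alpha>\<in>A. le {\<alpha>} A"
  using assms
proof (induction A rule: finite_ne_induct)
  case (singleton \<alpha>)
  then show ?case
    using counter_dominance entails_refl by blast
next
  case (insert \<alpha> A)
  have "mb_union le"
    using standard by (simp add: standard_def)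
  then have "le {\<alpha>} ({\<alpha>} \<union> A) \<or> le A ({\<alpha>} \<union> A)"
    using insert.hyps unfolding mb_union_def by blast
  moreover obtain \<beta> where "\<beta> \<in> A" "le {\<beta>} A"
    using insert.IH by blast
  ultimately show ?case
    using insert.hyps le_trans[of "{\<beta>}" A "insert \<alpha> A"] by auto
qed

lemma induced_success:
  assumes "finite A" "A \<noteq> {}"
  shows "A \<inter> induced A \<noteq> {}"
proof -
  obtain \<alpha> where \<alpha>: "\<alpha> \<in> A" "le {\<alpha>} A"
    using exists_most_believable assms by blast
  then have "A \<simeq> {\<alpha>}"
    using assms entails_refl by (auto simp: sym_part_def intro!: counter_dominance)
  then have "\<alpha> \<in> induced A"
    using coupling assms by (auto simp: induced_def)
  with \<alpha> show ?thesis by blast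
qed

lemma induced_closed:
  assumes "finite A" "A \<noteq> {}"
  shows "Cn (induced A) = induced A"
proof (rule Cn_fixpointI)
  show "induced A \<noteq> {}"
    using induced_success assms by blast
qed (fact induced_conj[OF assms(1)] induced_weaken[OF assms(1)])+

text \<open>A set meeting \<open>K\<close> is minimal, so \<open>conj_set A {\<phi>}\<close> lies
  below \<open>A\<close> iff it is minimal too, that is, iff it meets \<open>K\<close>. As
  \<open>K\<close> is closed, this amounts to \<open>\<phi> \<in> K\<close>.\<close>

lemma induced_confirmation:
  assumes "finite A" "A \<inter> K \<noteq> {}"
  shows "induced A = K"
proof -
  have "\<phi> \<in> induced A \<longleftrightarrow> \<phi> \<in> K" for \<phi>
  proof -
    have "le (conj_set A {\<phi>}) A \<longleftrightarrow> (\<forall>B. finite B \<longrightarrow> le (conj_set A {\<phi>}) B)"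
      using minimal_iff[of A] assms le_trans[of "conj_set A {\<phi>}" A] by auto
    also have "\<dots> \<longleftrightarrow> conj_set A {\<phi>} \<inter> K \<noteq> {}"
      using assms by (intro minimal_iff) auto
    also have "\<dots> \<longleftrightarrow> \<phi> \<in> K"
    proof -
      have "\<alpha> \<^bold>\<and> \<phi> \<in> K \<longleftrightarrow> \<alpha> \<in> K \<and> \<phi> \<in> K" for \<alpha>
        using belief Cn_conj_iff[of \<alpha> \<phi> K] by (simp add: belief_set_def)
      then show ?thesis
        using assms by (auto simp: conj_set_def)
    qed
    finally show ?thesis
      using assms by (simp add: induced_iff)
  qed
  then show ?thesis by blast
qed

text \<open>If \<open>\<beta>\<close> is in both sets, \<open>conj_set A {\<beta>}\<close> sits
  between \<open>B\<close> and \<open>A\<close>: its members entail \<open>\<beta>\<close>, and it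
  is below \<open>A\<close> by the choice of \<open>\<beta>\<close>.\<close>

lemma le_if_induced_meets:
  assumes "finite A" "finite B" "induced A \<inter> B \<noteq> {}"
  shows "le B A"
proof -
  obtain \<beta> where \<beta>: "\<beta> \<in> B" "\<beta> \<in> induced A"
    using assms by blast
  then have "le B (conj_set A {\<beta>})"
    using assms conj_entails_right by (intro counter_dominance) (auto elim!: conj_setE)
  then show ?thesis
    using assms \<beta> le_trans[of B "conj_set A {\<beta>}" A] by (simp add: induced_iff)
qed

text \<open>Coupling gives \<open>A \<simeq> conj_set A B\<close>, and weak coupling adjoins
  \<open>\<phi>\<close> to it. Dropping the conjunct from \<open>A\<close> leaves members of
  \<open>conj_set B {\<phi>}\<close>, so counter dominance transfers the bound to
  \<open>B\<close>.\<close>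

lemma induced_mono_sim:
  assumes "finite A" "finite B" "A \<simeq> B"
  shows "induced A \<subseteq> induced B"
proof
  fix \<phi>
  assume "\<phi> \<in> induced A"
  then have sim: "A \<simeq> conj_set (conj_set A B) {\<phi>}"
    using assms coupling weak_coupling by (simp add: induced_def)
  have "le (conj_set B {\<phi>}) (conj_set (conj_set A B) {\<phi>})"
    using assms entails_refl conj_entails_right
    by (intro le_conj_set_singleton) (auto elim!: conj_setE)
  then have "le (conj_set B {\<phi>}) A"
    using sim assms le_trans[of "conj_set B {\<phi>}" "conj_set (conj_set A B) {\<phi>}" A]
    by (simp add: sym_part_def)
  then show "\<phi> \<in> induced B"
    using assms le_trans[of "conj_set B {\<phi>}" A B] by (simp add: induced_iff sym_part_def)
qed

lemma induced_reciprocity: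
  assumes "finite A" "finite B" "induced A \<inter> B \<noteq> {}" "induced B \<inter> A \<noteq> {}"
  shows "induced A = induced B"
proof -
  have "A \<simeq> B"
    using assms by (auto simp: sym_part_def le_if_induced_meets)
  then show ?thesis
    using assms induced_mono_sim sim_sym by blast
qed

lemma induced_consistency:
  assumes "finite A" "A \<noteq> {}" "\<not> set_equivalent Cn A {\<^bold>\<bottom>}"
  shows "consistent Cn (induced A)"
proof (rule ccontr)
  assume "\<not> consistent Cn (induced A)"
  then have "le (conj_set A {\<^bold>\<bottom>}) A"
    using assms induced_closed by (simp add: consistent_def induced_iff)
  moreover have "le B (conj_set A {\<^bold>\<bottom>})" if "finite B" "B \<noteq> {}" for B
  proof (rule counter_dominance)
    fix \<chi>
    assume "\<chi> \<in> conj_set A {\<^bold>\<bottom>}"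
    then have "entails Cn \<chi> \<psi>" for \<psi>
      using entails_trans[OF conj_entails_right Falsum_entails] by (auto elim!: conj_setE)
    then show "\<exists>\<psi>\<in>B. entails Cn \<chi> \<psi>"
      using \<open>B \<noteq> {}\<close> by blast
  qed (use assms that in auto)
  ultimately have "\<forall>B. finite B \<longrightarrow> B \<noteq> {} \<longrightarrow> le B A"
    using assms le_trans[of _ "conj_set A {\<^bold>\<bottom>}" A] by simp
  moreover have "mb_maximality Cn le"
    using standard by (simp add: standard_def)
  ultimately show False
    using assms unfolding mb_maximality_def by blast
qed

text \<open>Stated for any \<open>R\<close> with these values at finite sets, since its values at
  infinite sets are left open.\<close>

lemma revision_postulates:
  assumes R: "\<And>A. finite A \<Longrightarrow> R A = (if A = {} then K else induced A)"
  shows "rev_closure Cn R \<and> rev_success R \<and> rev_vacuity K R \<and>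
         rev_confirmation K R \<and> rev_reciprocity R \<and> rev_consistency Cn R"
proof (intro conjI)
  show "rev_closure Cn R"
    using belief by (auto simp: rev_closure_def R induced_closed belief_set_def)
  show "rev_success R"
    using induced_success by (auto simp: rev_success_def R)
  show "rev_vacuity K R"
    by (simp add: rev_vacuity_def R)
  show "rev_confirmation K R"
    using induced_confirmation by (auto simp: rev_confirmation_def R)
  show "rev_reciprocity R"
    unfolding rev_reciprocity_def
  proof (intro allI impI)
    fix A B
    assume fin: "finite A" "finite B" and meet: "R A \<inter> B \<noteq> {}" "R B \<inter> A \<noteq> {}"
    \<comment> \<open>Each of the two sets is met by something, so both revisions fall under the
      \<open>induced\<close> branch.\<close>
    then have "A \<noteq> {}" "B \<noteq> {}"
      by auto
    then show "R A = R B"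
      using fin meet induced_reciprocity[of A B] by (simp add: R)
  qed
  show "rev_consistency Cn R"
    \<comment> \<open>The empty set is not equivalent to the contradiction, so its revision
      \<open>K\<close> must itself be consistent.\<close>
    using consistent_K induced_consistency by (auto simp: rev_consistency_def R)
qed

end


section \<open>The relation read off from a choice revision\<close>

section \<open>From revisions to relations\<close>

locale choice_revision = consequence_operation Cn
  for Cn :: "'v form set \<Rightarrow> 'v form set" +
  fixes K :: "'v form set" and R :: "'v revision"
  assumes belief: "belief_set Cn K"
    and closure: "rev_closure Cn R"
    and success: "rev_success R"
    and vacuity: "rev_vacuity K R"
    and confirmation: "rev_confirmation K R"
    and reciprocity: "rev_reciprocity R"
    and consistency: "rev_consistency Cn R"
begin

(* The first disjunct is needed only for A = B = {}, by success. *)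
definition rel :: "'v multi_bel" where
  "rel A B \<longleftrightarrow> B = {} \<or> R (A \<union> B) \<inter> A \<noteq> {}"

lemma Cn_R: "finite A \<Longrightarrow> Cn (R A) = R A"
  using closure by (auto simp: rev_closure_def)

lemma R_conj_iff: "finite A \<Longrightarrow> \<phi> \<^bold>\<and> \<psi> \<in> R A \<longleftrightarrow> \<phi> \<in> R A \<and> \<psi> \<in> R A"
  using Cn_conj_iff[of \<phi> \<psi> "R A"] Cn_R by simp

lemma R_entails: "finite A \<Longrightarrow> \<phi> \<in> R A \<Longrightarrow> entails Cn \<phi> \<psi> \<Longrightarrow> \<psi> \<in> R A"
  using Cn_entails[of \<phi> "R A" \<psi>] Cn_R by simp

lemma R_success: "finite A \<Longrightarrow> A \<noteq> {} \<Longrightarrow> R A \<inter> A \<noteq> {}"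
  using success by (auto simp: rev_success_def)

text \<open>Success puts an element of \<open>Y\<close>, hence of \<open>X\<close>, into
  \<open>R Y\<close>, which supplies the second premise of reciprocity.\<close>

lemma R_subset_eq:
  assumes "finite X" "Y \<subseteq> X" "R X \<inter> Y \<noteq> {}"
  shows "R Y = R X"
proof -
  have "finite Y" "Y \<noteq> {}"
    using assms finite_subset by auto
  then have "R Y \<inter> X \<noteq> {}"
    using R_success[of Y] assms by blast
  then show ?thesis
    using reciprocity \<open>finite Y\<close> assms unfolding rev_reciprocity_def by blast
qed

text \<open>All comparisons are moved to the revision by the union of the three sets. Success makes
  it meet one of them; from \<open>C\<close> one passes to \<open>B\<close>, from \<open>B\<close>
  to \<open>A\<close>, and the result is pulled back to \<open>A \<union> C\<close>.\<close>

lemma rel_trans: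
  assumes fin: "finite A" "finite B" "finite C" and "rel A B" "rel B C"
  shows "rel A C"
proof (cases "C = {}")
  case False
  let ?X = "A \<union> B \<union> C"
  have BC: "R (B \<union> C) \<inter> B \<noteq> {}"
    using assms False by (auto simp: rel_def)
  \<comment> \<open>The previous fact shows \<open>B\<close> to be non-empty, which excludes the
    first disjunct of \<open>rel A B\<close>.\<close>
  then have AB: "R (A \<union> B) \<inter> A \<noteq> {}"
    using assms by (auto simp: rel_def)
  have sub: "R Y = R ?X" if "Y \<subseteq> ?X" "R ?X \<inter> Y \<noteq> {}" for Y
    using R_subset_eq[of ?X Y] fin that by simp
  have "R ?X \<inter> ?X \<noteq> {}"
    using R_success[of ?X] fin False by simp
  moreover have "R ?X \<inter> B \<noteq> {}" if "R ?X \<inter> C \<noteq> {}"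
    using sub[of "B \<union> C"] that BC by blast
  moreover have "R ?X \<inter> A \<noteq> {}" if "R ?X \<inter> B \<noteq> {}"
    using sub[of "A \<union> B"] that AB by blast
  ultimately have "R ?X \<inter> A \<noteq> {}"
    by blast
  then show ?thesis
    using sub[of "A \<union> C"] by (auto simp: rel_def)
qed (simp add: rel_def)

text \<open>Success yields an accepted element of the union; if it comes from \<open>B\<close>,
  closure also accepts the element of \<open>A\<close> that it entails.\<close>

lemma rel_counter_dominance:
  assumes "finite A" "finite B" "\<And>\<phi>. \<phi> \<in> B \<Longrightarrow> \<exists>\<psi>\<in>A. entails Cn \<phi> \<psi>"
  shows "rel A B"
proof (cases "B = {}")
  case False
  then have "R (A \<union> B) \<inter> (A \<union> B) \<noteq> {}"
    using R_success[of "A \<union> B"] assms by simp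
  then show ?thesis
    using assms R_entails[of "A \<union> B"] unfolding rel_def by blast
qed (simp add: rel_def)

text \<open>Domination makes \<open>R (A \<union> B)\<close> meet \<open>A\<close>, so it equals
  \<open>R A\<close>. One half of the symmetric part then holds outright and the other says that
  \<open>R A\<close> meets \<open>B\<close>.\<close>

lemma sym_rel_iff_meets:
  assumes "finite A" "finite B" "A \<noteq> {}" "\<And>\<phi>. \<phi> \<in> B \<Longrightarrow> \<exists>\<psi>\<in>A. entails Cn \<phi> \<psi>"
  shows "sym_part rel A B \<longleftrightarrow> R A \<inter> B \<noteq> {}"
proof -
  have "R (A \<union> B) \<inter> (A \<union> B) \<noteq> {}"
    using R_success[of "A \<union> B"] assms by simp
  then have "R (A \<union> B) \<inter> A \<noteq> {}"
    using assms R_entails[of "A \<union> B"] by blast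
  then have "R A = R (A \<union> B)"
    using R_subset_eq[of "A \<union> B" A] assms by blast
  then show ?thesis
    using rel_counter_dominance[of A B] assms
    by (auto simp: sym_part_def rel_def Un_commute)
qed

text \<open>Success supplies an accepted element of \<open>A\<close> to conjoin with an accepted one
  of \<open>B\<close>. For singleton \<open>B\<close> this is the representation formula.\<close>

lemma sym_rel_conj_set_iff:
  assumes "finite A" "finite B" "A \<noteq> {}"
  shows "sym_part rel A (conj_set A B) \<longleftrightarrow> R A \<inter> B \<noteq> {}"
proof -
  have "sym_part rel A (conj_set A B) \<longleftrightarrow> R A \<inter> conj_set A B \<noteq> {}"
    using assms conj_entails_left by (intro sym_rel_iff_meets) (auto elim!: conj_setE)
  also have "\<dots> \<longleftrightarrow> R A \<inter> B \<noteq> {}"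
  proof
    assume "R A \<inter> conj_set A B \<noteq> {}"
    then show "R A \<inter> B \<noteq> {}"
      using assms R_conj_iff by (auto elim!: conj_setE)
  next
    assume "R A \<inter> B \<noteq> {}"
    then obtain \<alpha> \<beta> where "\<alpha> \<in> R A" "\<alpha> \<in> A" "\<beta> \<in> R A" "\<beta> \<in> B"
      using R_success[of A] assms by blast
    then have "\<alpha> \<^bold>\<and> \<beta> \<in> R A \<inter> conj_set A B"
      using assms R_conj_iff by (simp add: conj_setI)
    then show "R A \<inter> conj_set A B \<noteq> {}" by blast
  qed
  finally show ?thesis .
qed

lemma strict_rel_empty_iff: "strict_part rel A {} \<longleftrightarrow> A \<noteq> {}"
  by (auto simp: strict_part_def rel_def)

lemma sym_rel_empty: "sym_part rel {} {}"
  by (simp add: sym_part_def rel_def)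

text \<open>\<open>R A\<close> contains an element of each of the three sets and is closed under
  conjunction, so it contains their joint conjunction.\<close>

lemma rel_weak_coupling:
  assumes fin: "finite A" "finite B" "finite C"
    and AB: "sym_part rel A (conj_set A B)" and AC: "sym_part rel A (conj_set A C)"
  shows "sym_part rel A (conj_set (conj_set A B) C)"
proof (cases "A = {}")
  case False
  have "sym_part rel A (conj_set (conj_set A B) C) \<longleftrightarrow> R A \<inter> conj_set (conj_set A B) C \<noteq> {}"
  proof (rule sym_rel_iff_meets)
    fix \<chi>
    assume "\<chi> \<in> conj_set (conj_set A B) C"
    then obtain \<alpha> \<beta> \<gamma> where "\<alpha> \<in> A" "\<chi> = (\<alpha> \<^bold>\<and> \<beta>) \<^bold>\<and> \<gamma>"
      by (auto elim!: conj_setE)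
    then show "\<exists>\<psi>\<in>A. entails Cn \<chi> \<psi>"
      using entails_trans[OF conj_entails_left conj_entails_left] by blast
  qed (use fin False in auto)
  moreover have "R A \<inter> A \<noteq> {}" "R A \<inter> B \<noteq> {}" "R A \<inter> C \<noteq> {}"
    using AB AC fin False by (simp_all add: sym_rel_conj_set_iff R_success)
  then obtain \<alpha> \<beta> \<gamma> where "\<alpha> \<in> R A \<inter> A" "\<beta> \<in> R A \<inter> B" "\<gamma> \<in> R A \<inter> C"
    by blast
  then have "(\<alpha> \<^bold>\<and> \<beta>) \<^bold>\<and> \<gamma> \<in> R A \<inter> conj_set (conj_set A B) C"
    using fin R_conj_iff by (simp add: conj_setI)
  ultimately show ?thesis by blast
qed (simp add: sym_rel_empty)

lemma rel_coupling:
  assumes fin: "finite A" "finite B" and AB: "sym_part rel A B"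
  shows "sym_part rel A (conj_set A B)"
proof (cases "A = {}")
  case False
  \<comment> \<open>As \<open>A\<close> is non-empty, \<open>rel B A\<close> forces \<open>B\<close>
    to be non-empty, so both second disjuncts hold.\<close>
  then have meets: "R (A \<union> B) \<inter> A \<noteq> {}" "R (A \<union> B) \<inter> B \<noteq> {}"
    using AB by (auto simp: sym_part_def rel_def Un_commute)
  then have "R A = R (A \<union> B)"
    using R_subset_eq[of "A \<union> B" A] fin by blast
  then show ?thesis
    using meets fin False sym_rel_conj_set_iff by simp
qed (simp add: sym_rel_empty)

lemma rel_minimality:
  assumes "finite A"
  shows "(\<forall>B. finite B \<longrightarrow> rel A B) \<longleftrightarrow> A \<inter> K \<noteq> {}"
proof
  \<comment> \<open>A tautology lies in the belief set \<open>K\<close>, so by confirmation any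
    finite set containing it has revision \<open>K\<close>.\<close>
  let ?T = "\<^bold>\<bottom> \<^bold>\<rightarrow> \<^bold>\<bottom> :: 'v form"
  assume "\<forall>B. finite B \<longrightarrow> rel A B"
  then have "rel A {?T}"
    by simp
  then have "R (A \<union> {?T}) \<inter> A \<noteq> {}"
    by (simp add: rel_def)
  moreover have "?T \<in> K"
    using belief classical_CnI[of K ?T] by (simp add: belief_set_def)
  then have "finite (A \<union> {?T})" "(A \<union> {?T}) \<inter> K \<noteq> {}"
    using assms by auto
  then have "R (A \<union> {?T}) = K"
    using confirmation unfolding rev_confirmation_def by blast
  ultimately show "A \<inter> K \<noteq> {}" by blast
next
  assume meets: "A \<inter> K \<noteq> {}"
  have "R (A \<union> B) = K" if "finite B" for B
  proof -
    have "finite (A \<union> B)" "(A \<union> B) \<inter> K \<noteq> {}"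
      using assms that meets by auto
    then show ?thesis
      using confirmation unfolding rev_confirmation_def by blast
  qed
  then show "\<forall>B. finite B \<longrightarrow> rel A B"
    using meets by (auto simp: rel_def)
qed

text \<open>The test set is the contradiction alone: comparing it with \<open>B\<close> makes the
  revision by their union inconsistent, so consistency forces all of \<open>B\<close> to be
  contradictory.\<close>

lemma rel_maximality:
  assumes "finite B" "B \<noteq> {}" and max: "\<And>A. finite A \<Longrightarrow> A \<noteq> {} \<Longrightarrow> rel A B"
  shows "set_equivalent Cn B {\<^bold>\<bottom>}"
proof -
  have "R ({\<^bold>\<bottom>} \<union> B) \<inter> {\<^bold>\<bottom>} \<noteq> {}"
    using max[of "{\<^bold>\<bottom>}"] assms by (simp add: rel_def)
  then have "\<not> consistent Cn (R ({\<^bold>\<bottom>} \<union> B))"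
    using inclusion by (auto simp: consistent_def)
  moreover have "finite ({\<^bold>\<bottom>} \<union> B)"
    using assms by simp
  ultimately have "set_equivalent Cn ({\<^bold>\<bottom>} \<union> B) {\<^bold>\<bottom>}"
    using consistency unfolding rev_consistency_def by blast
  then show ?thesis
    using assms by (auto simp: set_equivalent_def equivalent_def)
qed

lemma standard_rel: "standard Cn K rel"
  unfolding standard_def
proof (intro conjI)
  show "mb_transitivity rel"
    using rel_trans unfolding mb_transitivity_def by blast
  show "mb_weak_coupling rel"
    using rel_weak_coupling
    unfolding mb_weak_coupling_def conj_set_triple conj_set_def[symmetric] by blast
  show "mb_coupling rel"
    using rel_coupling unfolding mb_coupling_def conj_set_def[symmetric] by blast
  show "mb_counter_dominance Cn rel"
    using rel_counter_dominance unfolding mb_counter_dominance_def by blast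
  show "mb_minimality K rel"
    using rel_minimality unfolding mb_minimality_def by blast
  show "mb_maximality Cn rel"
    using rel_maximality unfolding mb_maximality_def by blast
  show "mb_determination rel"
    by (simp add: mb_determination_def strict_rel_empty_iff)
  \<comment> \<open>Completeness and union both reduce to this instance of success, because
    \<open>A \<union> (A \<union> B)\<close> is again \<open>A \<union> B\<close>.\<close>
  have meets: "R (A \<union> B) \<inter> A \<noteq> {} \<or> R (A \<union> B) \<inter> B \<noteq> {}"
    if "finite A" "finite B" "A \<union> B \<noteq> {}" for A B
    using R_success[of "A \<union> B"] that by blast
  show "mb_completeness rel"
    unfolding mb_completeness_def rel_def using meets by (metis Un_commute Un_empty)
  show "mb_union rel"
    unfolding mb_union_def rel_def using meets
    by (metis Un_left_absorb Un_left_commute sup.idem)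
qed

lemma R_eq_rel:
  assumes "finite A"
  shows "R A = (if strict_part rel A {} then {\<phi>. sym_part rel A {\<psi> \<^bold>\<and> \<phi> | \<psi>. \<psi> \<in> A}} else K)"
proof (cases "A = {}")
  case True
  then show ?thesis
    using vacuity by (simp add: rev_vacuity_def strict_rel_empty_iff)
next
  case False
  then show ?thesis
    using assms sym_rel_conj_set_iff[of A]
    unfolding conj_set_singleton by (auto simp: strict_rel_empty_iff)
qed

end

theorem theorem5:
  fixes Cn :: "'v form set \<Rightarrow> 'v form set"
    and K :: "'v form set"
    and R :: "'v form set \<Rightarrow> 'v form set"
  assumes "consequence_operation Cn"
    and "belief_set Cn K" and "consistent Cn K"
  shows "(rev_closure Cn R \<and> rev_success R \<and> rev_vacuity K R \<and>
          rev_confirmation K R \<and> rev_reciprocity R \<and> rev_consistency Cn R) \<longleftrightarrow>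
         (\<exists>le. standard Cn K le \<and>
            (\<forall>A. finite A \<longrightarrow>
               R A = (if strict_part le A {}
                      then {\<phi>. sym_part le A {\<psi> \<^bold>\<and> \<phi> | \<psi>. \<psi> \<in> A}}
                      else K)))"
    (is "?postulates \<longleftrightarrow> (\<exists>le. ?represents le)")
proof
  assume ?postulates
  then interpret choice_revision Cn K R
    using assms by (simp add: choice_revision_def choice_revision_axioms_def)
  show "\<exists>le. ?represents le"
    using standard_rel R_eq_rel by blast
next
  assume "\<exists>le. ?represents le"
  then obtain le where le: "?represents le" ..
  then interpret standard_relation Cn K le
    using assms by (simp add: standard_relation_def standard_relation_axioms_def)
  \<comment> \<open>Determination has turned strictness below \<open>{}\<close> into non-emptiness,
    the form in which the postulates were derived.\<close>
  have "R A = (if A = {} then K else induced A)" if "finite A" for A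
    using le that by (simp add: strict_empty_iff induced_def conj_set_singleton)
  then show ?postulates
    by (rule revision_postulates)
qed

end
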